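(* Let $n\geqslant 1$ and $p\geqslant 0$ be integers, let $\sigma^n_{\langle 0\rangle}$ be an $n$-simplex in $\mathbb{R}^n$ with diameter $\mathrm{diam}(\sigma^n_{\langle 0\rangle})$, and let $\sigma^n_{\langle p\rangle}$ be the selected $n$-simplex produced after $p$ bisections of $\sigma^n_{\langle 0\rangle}$, with diameter $\mathrm{diam}(\sigma^n_{\langle p\rangle})$ and length of shortest edge $\mathrm{shor}(\sigma^n_{\langle p\rangle})$. Let $$\varepsilon^n_{\langle p\rangle} = \frac{n}{n+1}\Bigl(\mathrm{diam}\bigl(\sigma^n_{\langle p\rangle}\bigr)^2-\frac{n-1}{2n}\,\mathrm{shor}\bigl(\sigma^n_{\langle p\rangle}\bigr)^2\Bigr)^{1/2}$$ be the error estimate of $\sigma^n_{\langle p\rangle}$. Then $$\varepsilon^n_{\langle p\rangle} \leqslant \frac{n}{n+1}\bigl(\sqrt3/2\bigr)^{\lfloor p/n\rfloor}\,\mathrm{diam}\bigl(\sigma^n_{\langle 0\rangle}\bigr).$$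
   Context: An $n$-simplex in $\mathbb{R}^n$ is the convex hull of $n+1$ affinely independent points (its vertices); its diameter $\mathrm{diam}$ is the Euclidean length of its longest edge. Bisection: if $[\upsilon^i,\upsilon^j]$ is a longest edge of $[\upsilon^0,\ldots,\upsilon^n]$ and $M=(\upsilon^i+\upsilon^j)/2$, the bisection of the simplex consists of the two $n$-simplices obtained by replacing the vertex $\upsilon^i$ by $M$, respectively the vertex $\upsilon^j$ by $M$. The selected $n$-simplex produced after $p$ bisections of $\sigma^n_{\langle0\rangle}$ is the last term $\sigma^n_{\langle p\rangle}$ of a sequence $\sigma^n_{\langle0\rangle},\sigma^n_{\langle1\rangle},\ldots,\sigma^n_{\langle p\rangle}$ in which each $\sigma^n_{\langle k+1\rangle}$ is one (arbitrarily selected) of the two elements of the bisection of $\sigma^n_{\langle k\rangle}$. $\lfloor\cdot\rfloor$ is the floor function. *)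

theory Defs
  imports "HOL-Analysis.Analysis"
begin

text \<open>An n-simplex is the library's \<open>n simplex S\<close>: a convex hull of n + 1 affinely independent
  points.  These points are determined by the simplex (see \<open>vertices_convex_hull\<close> below).\<close>

definition vertices :: "'a::euclidean_space set \<Rightarrow> 'a set" where
  "vertices \<sigma> = (THE V. \<not> affine_dependent V \<and> \<sigma> = convex hull V)"

lemma vertices_convex_hull:
  assumes "\<not> affine_dependent V"
  shows "vertices (convex hull V) = V"
  unfolding vertices_def
proof (rule the_equality)
  show "\<not> affine_dependent V \<and> convex hull V = convex hull V"
    using assms by simp
next
  fix W
  assume "\<not> affine_dependent W \<and> convex hull V = convex hull W"
  then have "x \<in> W \<longleftrightarrow> x \<in> V" for x
    using assms extreme_point_of_convex_hull_affine_independent by metis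
  then show "W = V" by blast
qed

definition edge_lengths :: "'a::euclidean_space set \<Rightarrow> real set" where
  "edge_lengths \<sigma> = {dist a b | a b. a \<in> vertices \<sigma> \<and> b \<in> vertices \<sigma> \<and> a \<noteq> b}"

definition diam :: "'a::euclidean_space set \<Rightarrow> real" where
  "diam \<sigma> = Max (edge_lengths \<sigma>)"

definition shor :: "'a::euclidean_space set \<Rightarrow> real" where
  "shor \<sigma> = Min (edge_lengths \<sigma>)"

definition longest_edge :: "'a::euclidean_space set \<Rightarrow> 'a \<Rightarrow> 'a \<Rightarrow> bool" where
  "longest_edge \<sigma> a b \<longleftrightarrow>
     a \<in> vertices \<sigma> \<and> b \<in> vertices \<sigma> \<and> a \<noteq> b \<and> dist a b = diam \<sigma>"

definition bisection :: "'a::euclidean_space set \<Rightarrow> 'a \<Rightarrow> 'a \<Rightarrow> 'a set set" where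
  "bisection \<sigma> a b =
     {convex hull (insert (midpoint a b) (vertices \<sigma> - {a})),
      convex hull (insert (midpoint a b) (vertices \<sigma> - {b}))}"

text \<open>If there are several longest edges, any of them may be bisected, and either of the two
  resulting simplices may be selected.\<close>

definition selected_simplex ::
    "nat \<Rightarrow> 'a::euclidean_space set \<Rightarrow> 'a set \<Rightarrow> bool" where
  "selected_simplex p \<sigma> \<tau> \<longleftrightarrow>
     (\<exists>s :: nat \<Rightarrow> 'a set. s 0 = \<sigma> \<and> s p = \<tau> \<and>
        (\<forall>k<p. \<exists>a b. longest_edge (s k) a b \<and> s (Suc k) \<in> bisection (s k) a b))"

definition error_estimate :: "(real ^ 'n) set \<Rightarrow> real" where
  "error_estimate \<sigma> =
     (let n = real CARD('n)
      in n / (n + 1) * sqrt ((diam \<sigma>)\<^sup>2 - (n - 1) / (2 * n) * (shor \<sigma>)\<^sup>2))"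

end

theory Submission
  imports Defs
begin

text \<open>
  By the parallelogram law, the midpoint of a longest edge, of length \<open>L\<close>, has distance at most
  \<open>sqrt 3 / 2 * L\<close> from every other vertex.  So among the edges met during \<open>n\<close> successive
  bisections of a simplex of diameter \<open>D\<close>, only those between two original vertices can exceed
  \<open>sqrt 3 / 2 * D\<close>.  As long as such an edge exists, each bisection removes an original vertex;
  of the \<open>n + 1\<close> original vertices at most one is left after \<open>n\<close> bisections.  Hence \<open>n\<close> bisections
  shrink the diameter by the factor \<open>sqrt 3 / 2\<close>, and the error estimate of a simplex is at most
  \<open>n / (n + 1)\<close> times its diameter.
\<close>

section \<open>Midpoints: distances and affine independence\<close>

text \<open>Apollonius' formula for the length of a median: write everything in terms of
  \<open>a - c\<close> and \<open>b - c\<close> and expand the inner products.\<close>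

lemma dist_midpoint_power2:
  fixes a b c :: "'a::real_inner"
  shows "(dist (midpoint a b) c)\<^sup>2 = ((dist a c)\<^sup>2 + (dist b c)\<^sup>2) / 2 - (dist a b)\<^sup>2 / 4"
proof -
  have m: "midpoint a b - c = (1/2) *\<^sub>R ((a - c) + (b - c))"
    by (simp add: midpoint_def algebra_simps flip: scaleR_add_left)
  have ab: "a - b = (a - c) - (b - c)"
    by simp
  show ?thesis
    unfolding dist_norm m ab power2_norm_eq_inner
    by (simp only: inner_simps inner_commute[of "b - c" "a - c"]) (simp add: field_simps)
qed

text \<open>If the other two sides are at most L = \<open>dist a b\<close>, the squared median is at
  most L^2 - L^2/4, which is where the factor \<open>sqrt 3 / 2\<close> comes from.\<close>

lemma dist_midpoint_le:
  fixes a b c :: "'a::real_inner"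
  assumes "dist a c \<le> dist a b" "dist b c \<le> dist a b"
  shows "dist (midpoint a b) c \<le> sqrt 3 / 2 * dist a b"
proof (rule power2_le_imp_le)
  have "(dist a c)\<^sup>2 \<le> (dist a b)\<^sup>2" "(dist b c)\<^sup>2 \<le> (dist a b)\<^sup>2"
    by (auto intro: power_mono assms)
  then have "(dist (midpoint a b) c)\<^sup>2 \<le> 3 / 4 * (dist a b)\<^sup>2"
    unfolding dist_midpoint_power2 by argo
  also have "\<dots> = (sqrt 3 / 2 * dist a b)\<^sup>2"
    by (simp add: power_mult_distrib power_divide)
  finally show "(dist (midpoint a b) c)\<^sup>2 \<le> (sqrt 3 / 2 * dist a b)\<^sup>2" .
qed simp

lemma midpoint_notin_affine_hull:
  assumes "\<not> affine_dependent V" "a \<in> V" "b \<in> V" "a \<noteq> b"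
  shows "midpoint a b \<notin> affine hull (V - {a})"
proof
  assume m: "midpoint a b \<in> affine hull (V - {a})"
  have "b \<in> affine hull (V - {a})"
    using assms by (auto intro: hull_inc)
  \<comment> \<open>The coefficients 2 and -1 sum to 1, and this affine combination is
    \<open>a\<close> itself.\<close>
  then have "2 *\<^sub>R midpoint a b + (-1) *\<^sub>R b \<in> affine hull (V - {a})"
    by (intro mem_affine[OF affine_affine_hull m]) auto
  then have "a \<in> affine hull (V - {a})"
    by (simp add: midpoint_def)
  then show False
    using assms by (auto simp: affine_dependent_def)
qed

section \<open>Vertices, edges and diameter of a simplex\<close>

lemma
  assumes "n simplex \<sigma>"
  shows simplex_vertices_independent: "\<not> affine_dependent (vertices \<sigma>)"
    and simplex_card_vertices: "int (card (vertices \<sigma>)) = n + 1"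
  using assms by (auto simp: simplex_def vertices_convex_hull)

lemma finite_edge_lengths:
  assumes "n simplex \<sigma>"
  shows "finite (edge_lengths \<sigma>)"
proof -
  have "finite (vertices \<sigma>)"
    using assms aff_independent_finite simplex_vertices_independent by blast
  moreover have "edge_lengths \<sigma> \<subseteq> (\<lambda>(a, b). dist a b) ` (vertices \<sigma> \<times> vertices \<sigma>)"
    by (auto simp: edge_lengths_def)
  ultimately show ?thesis
    by (meson finite_SigmaI finite_imageI finite_subset)
qed

lemma edge_lengths_nonempty:
  assumes "n simplex \<sigma>" "n \<ge> 1"
  shows "edge_lengths \<sigma> \<noteq> {}"
proof -
  have "\<not> card (vertices \<sigma>) \<le> Suc 0"
    using simplex_card_vertices[OF assms(1)] assms(2) by linarith
  moreover have "finite (vertices \<sigma>)"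
    using assms aff_independent_finite simplex_vertices_independent by blast
  ultimately show ?thesis
    by (auto simp: edge_lengths_def card_le_Suc0_iff_eq)
qed

lemma dist_le_diam:
  assumes "n simplex \<sigma>" "a \<in> vertices \<sigma>" "b \<in> vertices \<sigma>" "a \<noteq> b"
  shows "dist a b \<le> diam \<sigma>"
  unfolding diam_def
  by (rule Max_ge[OF finite_edge_lengths[OF assms(1)]]) (use assms in \<open>auto simp: edge_lengths_def\<close>)

lemma diam_attained:
  assumes "n simplex \<sigma>" "n \<ge> 1"
  obtains a b where "a \<in> vertices \<sigma>" "b \<in> vertices \<sigma>" "a \<noteq> b" "diam \<sigma> = dist a b"
proof -
  have "diam \<sigma> \<in> edge_lengths \<sigma>"
    unfolding diam_def
    using Max_in[OF finite_edge_lengths[OF assms(1)] edge_lengths_nonempty[OF assms]] .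
  then show ?thesis
    using that by (auto simp: edge_lengths_def)
qed

lemma diam_le:
  assumes "n simplex \<sigma>" "n \<ge> 1"
    and "\<And>a b. \<lbrakk>a \<in> vertices \<sigma>; b \<in> vertices \<sigma>; a \<noteq> b\<rbrakk> \<Longrightarrow> dist a b \<le> d"
  shows "diam \<sigma> \<le> d"
  using diam_attained[OF assms(1,2)] assms(3) by metis

section \<open>A single bisection\<close>

text \<open>The two halves differ only by swapping the ends of the edge, so the ends can be named
  such that \<open>a\<close> is the vertex replaced.\<close>

lemma bisection_obtains:
  assumes "\<exists>a b. longest_edge \<sigma> a b \<and> \<tau> \<in> bisection \<sigma> a b"
  obtains a b where "longest_edge \<sigma> a b"
    "\<tau> = convex hull (insert (midpoint a b) (vertices \<sigma> - {a}))"
proof -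
  obtain a b where ab: "longest_edge \<sigma> a b" "\<tau> \<in> bisection \<sigma> a b"
    using assms by blast
  then have "longest_edge \<sigma> b a"
    by (auto simp: longest_edge_def dist_commute)
  moreover have "\<tau> = convex hull (insert (midpoint a b) (vertices \<sigma> - {a})) \<or>
      \<tau> = convex hull (insert (midpoint b a) (vertices \<sigma> - {b}))"
    using ab(2) by (simp add: bisection_def midpoint_sym[of b a])
  ultimately show ?thesis
    using that ab(1) by blast
qed

text \<open>The midpoint lies outside the affine hull of the remaining vertices, so the new vertex
  set is affinely independent; this gives both claims.\<close>

lemma
  assumes "n simplex \<sigma>" "longest_edge \<sigma> a b"
    and \<tau>: "\<tau> = convex hull (insert (midpoint a b) (vertices \<sigma> - {a}))"
  shows simplex_bisection: "n simplex \<tau>"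
    and vertices_bisection: "vertices \<tau> = insert (midpoint a b) (vertices \<sigma> - {a})"
proof -
  let ?V = "vertices \<sigma>" and ?W = "insert (midpoint a b) (vertices \<sigma> - {a})"
  have V: "\<not> affine_dependent ?V" and ab: "a \<in> ?V" "b \<in> ?V" "a \<noteq> b"
    using assms simplex_vertices_independent by (auto simp: longest_edge_def)
  have m: "midpoint a b \<notin> affine hull (?V - {a})"
    using midpoint_notin_affine_hull[OF V ab] .
  have W: "\<not> affine_dependent ?W"
    using affine_independent_insert[OF _ m] affine_dependent_subset[OF _ Diff_subset] V by metis
  then show "vertices \<tau> = ?W"
    by (simp add: \<tau> vertices_convex_hull)
  have "midpoint a b \<notin> ?V - {a}"
    using m hull_inc by metis
  then have "card ?W = card ?V"
    using aff_independent_finite[OF V] ab card.remove[of ?V a] by simp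
  then show "n simplex \<tau>"
    using W simplex_card_vertices[OF assms(1)] \<tau> unfolding simplex_def by auto
qed

lemma dist_bisection_midpoint_le:
  assumes "n simplex \<sigma>" "longest_edge \<sigma> a b" "c \<in> vertices \<sigma> - {a}"
  shows "dist (midpoint a b) c \<le> sqrt 3 / 2 * diam \<sigma>"
proof -
  have "diam \<sigma> = dist a b" "a \<in> vertices \<sigma>" "b \<in> vertices \<sigma>"
    using assms by (auto simp: longest_edge_def)
  then show ?thesis
    using dist_midpoint_le[of a c b] dist_le_diam[OF assms(1)] assms(3)
    \<comment> \<open>\<open>dist_le_diam\<close> needs distinct points; for \<open>c = b\<close>
      the bound on \<open>dist b c\<close> is trivial.\<close>
    by (cases "b = c") auto
qed

lemma diam_nonneg:
  assumes "n simplex \<sigma>" "n \<ge> 1"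
  shows "0 \<le> diam \<sigma>"
  using diam_attained[OF assms] by (metis zero_le_dist)

lemma sqrt_3_half_mult_le:
  assumes "(0::real) \<le> d"
  shows "sqrt 3 / 2 * d \<le> d"
proof -
  have "sqrt 3 \<le> 2"
    by (rule real_le_lsqrt) auto
  then show ?thesis
    using mult_left_le_one_le[OF assms, of "sqrt 3 / 2"] by simp
qed

lemma diam_bisection_le:
  assumes "n simplex \<sigma>" "n \<ge> 1" "longest_edge \<sigma> a b"
    and \<tau>: "\<tau> = convex hull (insert (midpoint a b) (vertices \<sigma> - {a}))"
  shows "diam \<tau> \<le> diam \<sigma>"
proof (rule diam_le[OF simplex_bisection[OF assms(1,3) \<tau>] assms(2)])
  have m: "dist (midpoint a b) c \<le> diam \<sigma>" if "c \<in> vertices \<sigma> - {a}" for c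
    using dist_bisection_midpoint_le[OF assms(1,3) that] sqrt_3_half_mult_le[OF diam_nonneg[OF assms(1,2)]]
    by linarith
  fix x y
  assume "x \<in> vertices \<tau>" "y \<in> vertices \<tau>" "x \<noteq> y"
  then show "dist x y \<le> diam \<sigma>"
    unfolding vertices_bisection[OF assms(1,3) \<tau>]
    using m dist_le_diam[OF assms(1)] by (auto simp: dist_commute)
qed

section \<open>Sequences of bisections\<close>

lemma selected_simplex_0: "selected_simplex 0 \<sigma> \<tau> \<longleftrightarrow> \<tau> = \<sigma>"
  by (auto simp: selected_simplex_def)

lemma selected_simplex_add:
  assumes "selected_simplex (p + q) \<sigma> \<tau>"
  obtains \<rho> where "selected_simplex p \<sigma> \<rho>" "selected_simplex q \<rho> \<tau>"
proof -
  obtain s where s: "s 0 = \<sigma>" "s (p + q) = \<tau>"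
      "\<forall>k<p + q. \<exists>a b. longest_edge (s k) a b \<and> s (Suc k) \<in> bisection (s k) a b"
    using assms by (auto simp: selected_simplex_def)
  have "selected_simplex p \<sigma> (s p)"
    using s by (auto simp: selected_simplex_def)
  moreover have "selected_simplex q (s p) \<tau>"
    unfolding selected_simplex_def using s by (intro exI[of _ "\<lambda>k. s (p + k)"]) auto
  ultimately show ?thesis
    using that by blast
qed

lemma selected_simplex_Suc:
  assumes "selected_simplex (Suc p) \<sigma> \<tau>"
  obtains \<rho> a b where "selected_simplex p \<sigma> \<rho>" "longest_edge \<rho> a b"
    "\<tau> = convex hull (insert (midpoint a b) (vertices \<rho> - {a}))"
proof -
  obtain \<rho> where \<rho>: "selected_simplex p \<sigma> \<rho>" "selected_simplex 1 \<rho> \<tau>"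
    using selected_simplex_add[of p 1] assms by auto
  then have "\<exists>a b. longest_edge \<rho> a b \<and> \<tau> \<in> bisection \<rho> a b"
    by (auto simp: selected_simplex_def)
  then show ?thesis
    using \<rho>(1) that by (elim bisection_obtains) blast
qed

lemma simplex_selected:
  assumes "n simplex \<sigma>" "selected_simplex p \<sigma> \<tau>"
  shows "n simplex \<tau>"
  using assms(2)
proof (induction p arbitrary: \<tau>)
  case 0
  then show ?case
    using assms(1) by (simp add: selected_simplex_0)
next
  case (Suc p)
  then show ?case
    by (metis selected_simplex_Suc simplex_bisection)
qed

lemma diam_selected_le:
  assumes "n simplex \<sigma>" "n \<ge> 1" "selected_simplex p \<sigma> \<tau>"
  shows "diam \<tau> \<le> diam \<sigma>"
  using assms(3)
proof (induction p arbitrary: \<tau>)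
  case 0
  then show ?case
    by (simp add: selected_simplex_0)
next
  case (Suc p)
  then obtain \<rho> a b where \<rho>: "selected_simplex p \<sigma> \<rho>" "longest_edge \<rho> a b"
      "\<tau> = convex hull (insert (midpoint a b) (vertices \<rho> - {a}))"
    by (blast elim: selected_simplex_Suc)
  then show ?case
    using diam_bisection_le[OF simplex_selected[OF assms(1) \<rho>(1)] assms(2) \<rho>(2,3)] Suc.IH[OF \<rho>(1)]
    by linarith
qed

section \<open>Shrinking of the diameter by n bisections\<close>

text \<open>\<open>U\<close> is the set of the original vertices that are still present.\<close>

lemma selected_diam_or_old_vertices:
  assumes "int n simplex \<sigma>" "n \<ge> 1" "selected_simplex p \<sigma> \<tau>"
  shows "diam \<tau> \<le> sqrt 3 / 2 * diam \<sigma> \<or>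
    (\<exists>U. finite U \<and> card U + p = n + 1 \<and>
      (\<forall>x\<in>vertices \<tau>. \<forall>y\<in>vertices \<tau>.
        x \<noteq> y \<longrightarrow> \<not> {x, y} \<subseteq> U \<longrightarrow> dist x y \<le> sqrt 3 / 2 * diam \<sigma>))"
    (is "?small \<tau> \<or> (\<exists>U. ?old p \<tau> U)")
  using assms(3)
proof (induction p arbitrary: \<tau>)
  case 0
  \<comment> \<open>Initially every edge has both ends in \<open>U\<close>, so the distance
    condition is vacuous.\<close>
  then have "?old 0 \<tau> (vertices \<sigma>)"
    using simplex_card_vertices[OF assms(1)] simplex_vertices_independent[OF assms(1)]
      aff_independent_finite by (auto simp: selected_simplex_0)
  then show ?case
    by blast
next
  case (Suc p)
  then obtain \<rho> a b where \<rho>: "selected_simplex p \<sigma> \<rho>" and ab: "longest_edge \<rho> a b"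
      and \<tau>: "\<tau> = convex hull (insert (midpoint a b) (vertices \<rho> - {a}))"
    by (blast elim: selected_simplex_Suc)
  have simp_\<rho>: "int n simplex \<rho>"
    using simplex_selected[OF assms(1) \<rho>] .
  have n: "int n \<ge> 1"
    using assms(2) by simp
  show ?case
  proof (cases "?small \<rho>")
    case True
    then show ?thesis
      using diam_bisection_le[OF simp_\<rho> n ab \<tau>] by linarith
  next
    case False
    then obtain U where U: "?old p \<rho> U"
      using Suc.IH[OF \<rho>] by blast
    \<comment> \<open>The longest edge of \<rho> exceeds the bound, so the invariant forces both its
      ends into \<open>U\<close>; bisecting it therefore costs \<open>U\<close> the element
      \<open>a\<close>.\<close>
    have "{a, b} \<subseteq> U"
      using U ab False unfolding longest_edge_def by metis
    then have card: "card (U - {a}) + Suc p = n + 1"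
      using U card.remove[of U a] by simp
    have mid: "dist (midpoint a b) c \<le> sqrt 3 / 2 * diam \<sigma>" if "c \<in> vertices \<rho> - {a}" for c
      using dist_bisection_midpoint_le[OF simp_\<rho> ab that] diam_selected_le[OF assms(1) n \<rho>]
      by (smt (verit) real_sqrt_ge_zero mult_left_mono divide_nonneg_nonneg)
    \<comment> \<open>Either one end is the new midpoint, or both ends are vertices of \<rho> other
      than \<open>a\<close>, in which case the pair already failed to lie in
      \<open>U\<close>.\<close>
    have "dist x y \<le> sqrt 3 / 2 * diam \<sigma>"
      if "x \<in> vertices \<tau>" "y \<in> vertices \<tau>" "x \<noteq> y" "\<not> {x, y} \<subseteq> U - {a}" for x y
      using that U mid mid[unfolded dist_commute[of "midpoint a b"]]
      unfolding vertices_bisection[OF simp_\<rho> ab \<tau>] by auto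
    then have "?old (Suc p) \<tau> (U - {a})"
      using U card by blast
    then show ?thesis
      by blast
  qed
qed

text \<open>After n steps \<open>U\<close> is a singleton and contains no edge, so both alternatives
  of the previous lemma bound every edge.\<close>

lemma diam_selected_dim_le:
  assumes "int n simplex \<sigma>" "n \<ge> 1" "selected_simplex n \<sigma> \<tau>"
  shows "diam \<tau> \<le> sqrt 3 / 2 * diam \<sigma>"
proof -
  have "diam \<tau> \<le> sqrt 3 / 2 * diam \<sigma>"
    if card: "card U + n = n + 1"
      and U: "\<forall>x\<in>vertices \<tau>. \<forall>y\<in>vertices \<tau>.
        x \<noteq> y \<longrightarrow> \<not> {x, y} \<subseteq> U \<longrightarrow> dist x y \<le> sqrt 3 / 2 * diam \<sigma>" for U
  proof (rule diam_le[OF simplex_selected[OF assms(1,3)]])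
    obtain u where "U = {u}"
      using card card_1_singletonE[of U] by auto
    then show "dist x y \<le> sqrt 3 / 2 * diam \<sigma>"
      if "x \<in> vertices \<tau>" "y \<in> vertices \<tau>" "x \<noteq> y" for x y
      using U that by auto
  qed (use assms in simp)
  then show ?thesis
    using selected_diam_or_old_vertices[OF assms] by blast
qed

section \<open>Iteration and the error estimate\<close>

text \<open>Each block of n bisections contributes one factor; the remaining \<open>r\<close> only
  need not increase the diameter. The induction splits off the first block, hence \<sigma> is
  arbitrary.\<close>

lemma diam_selected_power_le:
  assumes "int n simplex \<sigma>" "n \<ge> 1" "selected_simplex (n * k + r) \<sigma> \<tau>"
  shows "diam \<tau> \<le> (sqrt 3 / 2) ^ k * diam \<sigma>"
  using assms(1,3)
proof (induction k arbitrary: \<sigma>)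
  case 0
  then show ?case
    using diam_selected_le[of "int n"] assms(2) by simp
next
  case (Suc k)
  obtain \<rho> where \<rho>: "selected_simplex n \<sigma> \<rho>" "selected_simplex (n * k + r) \<rho> \<tau>"
    using selected_simplex_add[of n "n * k + r"] Suc.prems(2) by (auto simp: add.assoc)
  have "diam \<tau> \<le> (sqrt 3 / 2) ^ k * diam \<rho>"
    using Suc.IH[OF simplex_selected[OF Suc.prems(1) \<rho>(1)] \<rho>(2)] .
  also have "\<dots> \<le> (sqrt 3 / 2) ^ k * (sqrt 3 / 2 * diam \<sigma>)"
    using diam_selected_dim_le[OF Suc.prems(1) assms(2) \<rho>(1)] by (intro mult_left_mono) auto
  finally show ?case
    by (simp add: mult_ac)
qed

text \<open>As the dimension is at least 1, the term subtracted under the root is nonnegative, so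
  the root is at most the diameter.\<close>

lemma error_estimate_le:
  fixes \<sigma> :: "(real ^ 'n) set"
  assumes "0 \<le> diam \<sigma>"
  shows "error_estimate \<sigma> \<le> real CARD('n) / (real CARD('n) + 1) * diam \<sigma>"
proof -
  have "real CARD('n) \<ge> 1"
    by (simp add: Suc_leI)
  then have "(diam \<sigma>)\<^sup>2 - (real CARD('n) - 1) / (2 * real CARD('n)) * (shor \<sigma>)\<^sup>2 \<le> (diam \<sigma>)\<^sup>2"
    by simp
  then show ?thesis
    unfolding error_estimate_def Let_def
    by (intro mult_left_mono real_le_lsqrt) (use assms in auto)
qed

theorem lemma3p50:
  fixes \<sigma>\<^sub>0 \<sigma>\<^sub>p :: "(real ^ 'n) set" and p :: nat
  assumes "int CARD('n) simplex \<sigma>\<^sub>0"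
    and "selected_simplex p \<sigma>\<^sub>0 \<sigma>\<^sub>p"
  shows "error_estimate \<sigma>\<^sub>p
           \<le> real CARD('n) / (real CARD('n) + 1)
              * (sqrt 3 / 2) ^ nat \<lfloor>real p / real CARD('n)\<rfloor> * diam \<sigma>\<^sub>0"
proof -
  let ?n = "CARD('n)"
  have n: "?n \<ge> 1"
    by (simp add: Suc_leI)
  \<comment> \<open>Division with remainder gives the number of full blocks, which is the floor in
    the exponent.\<close>
  have "selected_simplex (?n * (p div ?n) + p mod ?n) \<sigma>\<^sub>0 \<sigma>\<^sub>p"
    using assms(2) by simp
  then have "diam \<sigma>\<^sub>p \<le> (sqrt 3 / 2) ^ (p div ?n) * diam \<sigma>\<^sub>0"
    using diam_selected_power_le[OF assms(1) n] by blast
  moreover have "error_estimate \<sigma>\<^sub>p \<le> real ?n / (real ?n + 1) * diam \<sigma>\<^sub>p"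
    using diam_nonneg[OF simplex_selected[OF assms]] n by (intro error_estimate_le) simp
  moreover have "nat \<lfloor>real p / real ?n\<rfloor> = p div ?n"
    by (simp add: floor_divide_of_nat_eq)
  ultimately show ?thesis
    by (smt (verit) mult.assoc mult_left_mono divide_nonneg_nonneg of_nat_0_le_iff)
qed

end
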